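(* Let $N,M,C_{\mathrm{in}},C\ge 1$ be integers and let $T,T'>0$ be sampling periods with $NT=MT'$. Let $f:(\mathbb{R}^{N})^{C_{\mathrm{in}}}\to(\mathbb{R}^{M})^{C}$ be a map that is shift-equivariant with respect to the continuous domain, i.e. $f(\tau_\Delta(x))=\tau_\Delta(f(x))$ for every $x\in(\mathbb{R}^{N})^{C_{\mathrm{in}}}$ and every $\Delta\in\mathbb{R}$, where on the left $\tau_\Delta$ is fractional translation with sampling period $T$ and on the right it is fractional translation with sampling period $T'$. Let $A:(\mathbb{R}^{M})^{C}\to\mathbb{R}^{C}$ be global average pooling, $A(y)_c=\frac1M\sum_{n=0}^{M-1}y_c[n]$, and let $g:\mathbb{R}^{C}\to\mathbb{R}^{q}$ be an arbitrary map (the classifier). Then the whole model $h=g\circ A\circ f$ is shift-invariant with respect to the continuous domain: $h(\tau_\Delta(x))=h(x)$ for every $x\in(\mathbb{R}^{N})^{C_{\mathrm{in}}}$ and every $\Delta\in\mathbb{R}$.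
   Context: A vector $x\in\mathbb{R}^{N}$ is viewed as one period of an $N$-periodic discrete signal sampled with period $T>0$. Its continuous-domain representation is the $NT$-periodic function $$z(t)=\frac1N\sum_{|k|<N/2}\hat x[k]\,e^{2\pi i k t/(NT)}+\varepsilon_N\,\frac1N\,\hat x[N/2]\cos\!\Big(\frac{\pi t}{T}\Big),$$ where $k$ ranges over integers, $\hat x[k]=\sum_{n=0}^{N-1}x[n]e^{-2\pi i kn/N}$, and $\varepsilon_N=1$ if $N$ is even and $\varepsilon_N=0$ if $N$ is odd; it satisfies $z(nT)=x[n]$. For $\Delta\in\mathbb{R}$ the fractional translation is $\tau_\Delta(x)[n]=z(nT+\Delta)$, $0\le n\le N-1$. On multi-channel signals $\tau_\Delta$ acts on each channel separately. The same definitions are used for vectors in $\mathbb{R}^{M}$ with sampling period $T'$. The condition $NT=MT'$ says that input and output cover the same continuous period; $M<N$ models downsampling. *)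

theory Defs
  imports "HOL-Analysis.Analysis"
begin

text \<open>
  Vectors of length \<open>N\<close> are functions on \<open>nat\<close> that are \<^const>\<open>undefined\<close> outside
  \<open>{..<N}\<close>, so that equality in \<open>real_vecs N\<close> is equality of the \<open>N\<close> entries.  In
  \<open>signals C N\<close> the first index is the channel and the second is the sample.
\<close>

definition real_vecs :: "nat \<Rightarrow> (nat \<Rightarrow> real) set" where
  "real_vecs N = {..<N} \<rightarrow>\<^sub>E UNIV"

definition signals :: "nat \<Rightarrow> nat \<Rightarrow> (nat \<Rightarrow> nat \<Rightarrow> real) set" where
  "signals C N = {..<C} \<rightarrow>\<^sub>E real_vecs N"

definition dft :: "nat \<Rightarrow> (nat \<Rightarrow> real) \<Rightarrow> int \<Rightarrow> complex" where
  "dft N x k =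
     (\<Sum>n<N. of_real (x n) * exp (- (2 * of_real pi * \<i> * of_int k * of_nat n) / of_nat N))"

definition cont_rep :: "nat \<Rightarrow> real \<Rightarrow> (nat \<Rightarrow> real) \<Rightarrow> real \<Rightarrow> complex" where
  "cont_rep N T x t =
     1 / of_nat N *
       (\<Sum>k\<in>{k::int. \<bar>real_of_int k\<bar> < real N / 2}.
          dft N x k * exp (2 * of_real pi * \<i> * of_int k * of_real t / of_real (real N * T)))
     + (if even N then 1 else 0) *
       (1 / of_nat N * dft N x (int (N div 2)) * of_real (cos (pi * t / T)))"

text \<open>
  \<^const>\<open>cont_rep\<close> takes values in \<^typ>\<open>complex\<close> only because its summands are complex.  Lemma
  \<open>cont_rep_real\<close> shows that its values are real, so \<^const>\<open>Re\<close> in \<open>frac_translate\<close>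
  discards nothing.
\<close>

definition frac_translate :: "nat \<Rightarrow> real \<Rightarrow> real \<Rightarrow> (nat \<Rightarrow> real) \<Rightarrow> (nat \<Rightarrow> real)" where
  "frac_translate N T \<Delta> x = (\<lambda>n\<in>{..<N}. Re (cont_rep N T x (real n * T + \<Delta>)))"

definition signal_translate ::
  "nat \<Rightarrow> nat \<Rightarrow> real \<Rightarrow> real \<Rightarrow> (nat \<Rightarrow> nat \<Rightarrow> real) \<Rightarrow> (nat \<Rightarrow> nat \<Rightarrow> real)" where
  "signal_translate C N T \<Delta> x = (\<lambda>c\<in>{..<C}. frac_translate N T \<Delta> (x c))"

definition shift_equivariant ::
  "nat \<Rightarrow> nat \<Rightarrow> real \<Rightarrow> nat \<Rightarrow> nat \<Rightarrow> real \<Rightarrow>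
     ((nat \<Rightarrow> nat \<Rightarrow> real) \<Rightarrow> (nat \<Rightarrow> nat \<Rightarrow> real)) \<Rightarrow> bool" where
  "shift_equivariant Cin N T C M T' f \<longleftrightarrow>
     (\<forall>x\<in>signals Cin N. \<forall>\<Delta>.
        f (signal_translate Cin N T \<Delta> x) = signal_translate C M T' \<Delta> (f x))"

definition shift_invariant ::
  "nat \<Rightarrow> nat \<Rightarrow> real \<Rightarrow> ((nat \<Rightarrow> nat \<Rightarrow> real) \<Rightarrow> 'a) \<Rightarrow> bool" where
  "shift_invariant Cin N T h \<longleftrightarrow>
     (\<forall>x\<in>signals Cin N. \<forall>\<Delta>. h (signal_translate Cin N T \<Delta> x) = h x)"

definition global_avg_pool :: "nat \<Rightarrow> nat \<Rightarrow> (nat \<Rightarrow> nat \<Rightarrow> real) \<Rightarrow> (nat \<Rightarrow> real)" where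
  "global_avg_pool C M y = (\<lambda>c\<in>{..<C}. 1 / real M * (\<Sum>n<M. y c n))"

lemma cnj_dft: "cnj (dft N x k) = dft N x (- k)"
  by (simp add: dft_def exp_cnj)

lemma dft_nyquist_real:
  assumes "even N"
  shows "dft N x (int (N div 2)) \<in> \<real>"
proof (cases "N = 0")
  case True
  then show ?thesis by (simp add: dft_def)
next
  case False
  have "exp (- (2 * of_real pi * \<i> * of_int (int (N div 2)) * of_nat n) / of_nat N) = (-1 :: complex) ^ n"
    for n
  proof -
    have h: "(of_nat N :: complex) = 2 * of_nat (N div 2)"
      using assms by (metis dvd_mult_div_cancel of_nat_mult of_nat_numeral)
    have "of_nat (N div 2) \<noteq> (0 :: complex)"
      using False assms by (metis dvd_mult_div_cancel mult_0_right of_nat_eq_0_iff)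
    then have "- (2 * of_real pi * \<i> * of_int (int (N div 2)) * of_nat n) / of_nat N
        = of_nat n * (- (of_real pi * \<i>))"
      unfolding h by (simp add: field_simps)
    then have "exp (- (2 * of_real pi * \<i> * of_int (int (N div 2)) * of_nat n) / of_nat N)
        = exp (- (of_real pi * \<i>)) ^ n"
      by (simp only: exp_of_nat_mult)
    then show ?thesis by (simp add: exp_minus)
  qed
  then show ?thesis
    unfolding dft_def by (auto intro!: sum_in_Reals Reals_mult Reals_power)
qed

lemma cont_rep_real: "cont_rep N T x t \<in> \<real>"
proof -
  let ?K = "{k::int. \<bar>real_of_int k\<bar> < real N / 2}"
  let ?F = "\<lambda>k. dft N x k * exp (2 * of_real pi * \<i> * of_int k * of_real t / of_real (real N * T))"
  have "cnj (sum ?F ?K) = (\<Sum>k\<in>?K. ?F (- k))"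
    by (simp add: cnj_dft exp_cnj)
  also have "\<dots> = sum ?F ?K"
    by (rule sum.reindex_bij_witness[of _ uminus uminus]) auto
  finally have "sum ?F ?K \<in> \<real>"
    by (simp add: Reals_cnj_iff)
  then show ?thesis
    unfolding cont_rep_def
    using dft_nyquist_real[of N x] by (auto intro!: Reals_add Reals_mult Reals_divide)
qed

end

theory Submission
  imports Defs
begin

text \<open>
  Summing the interpolant over the sampling grid, shifted by any amount, kills every nonconstant
  frequency: each one below the Nyquist frequency contributes a geometric sum over roots of unity,
  and the Nyquist cosine alternates in sign along the grid.  Fractional translation therefore
  preserves the mean of a channel, so that global average pooling is itself shift-invariant.
\<close>

text \<open>The period \<open>T\<close> cancels from the \<open>n\<close>-dependent part of the
  exponent, so the terms are \<open>e * w ^ n\<close>: the shift \<open>d\<close> enters only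
  through the common factor \<open>e\<close>, and \<open>w\<close> is an \<open>M\<close>-th root of
  unity. The bound on \<open>k\<close> makes 0 the only multiple of \<open>M\<close> in range, hence
  \<open>w = 1\<close> only for \<open>k = 0\<close>.\<close>

lemma sum_shifted_character:
  fixes k :: int
  assumes "M > 0" "T \<noteq> 0" "\<bar>real_of_int k\<bar> < real M"
  shows "(\<Sum>n<M. exp (2 * of_real pi * \<i> * of_int k * of_real (real n * T + d) / of_real (real M * T)))
    = (if k = 0 then of_nat M else 0 :: complex)"
proof (cases "k = 0")
  case False
  define w :: complex where "w = exp (2 * of_real pi * \<i> * of_int k / of_nat M)"
  define e :: complex where "e = exp (2 * of_real pi * \<i> * of_int k * of_real d / of_real (real M * T))"
  have shift: "exp (2 * of_real pi * \<i> * of_int k * of_real (real n * T + d) / of_real (real M * T))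
      = e * w ^ n" for n
  proof -
    have "2 * of_real pi * \<i> * of_int k * of_real (real n * T + d) / of_real (real M * T)
      = 2 * of_real pi * \<i> * of_int k * of_real d / of_real (real M * T)
        + of_nat n * (2 * of_real pi * \<i> * of_int k / of_nat M :: complex)"
      using assms(1,2) by (simp add: field_simps)
    then show ?thesis
      by (simp only: exp_add exp_of_nat_mult e_def w_def)
  qed
  have "w \<noteq> 1"
  proof
    assume "w = 1"
    \<comment> \<open>Comparing imaginary parts of the exponent, \<open>w = 1\<close> would make
      \<open>k\<close> a multiple of \<open>M\<close>.\<close>
    then obtain j :: int where "2 * pi * real_of_int k / real M = real_of_int (2 * j) * pi"
      by (auto simp: w_def exp_eq_1)
    then have "real_of_int k = real_of_int j * real M"
      using assms(1) by (simp add: field_simps)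
    then have "k = j * int M"
      by (metis of_int_eq_iff of_int_mult of_int_of_nat_eq)
    moreover have "\<bar>k\<bar> < int M"
      using assms(3) by linarith
    ultimately show False
      using False by (metis dvd_triv_right zdvd_not_zless abs_of_nonneg dvd_abs_iff zero_less_abs_iff)
  qed
  moreover have "w ^ M = 1"
  proof -
    have "w ^ M = exp (of_nat M * (2 * of_real pi * \<i> * of_int k / of_nat M))"
      by (simp only: w_def exp_of_nat_mult)
    also have "\<dots> = exp (2 * of_int k * of_real pi * \<i>)"
      using assms(1) by (simp add: mult_ac)
    also have "\<dots> = 1"
      by (auto simp: exp_eq_1)
    finally show ?thesis .
  qed
  ultimately have "(\<Sum>n<M. w ^ n) = 0"
    by (simp add: geometric_sum)
  then show ?thesis
    using False by (simp only: shift sum_distrib_left[symmetric]) simp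
qed simp

lemma sum_shifted_nyquist:
  assumes "even M" "T \<noteq> 0"
  shows "(\<Sum>n<M. cos (pi * (real n * T + d) / T)) = 0"
proof -
  have "pi * (real n * T + d) / T = pi * d / T + pi * real n" for n
    using assms(2) by (simp add: field_simps)
  \<comment> \<open>The sine term of the addition formula vanishes because
    \<open>sin (pi * n) = 0\<close>.\<close>
  then have "cos (pi * (real n * T + d) / T) = cos (pi * d / T) * (-1) ^ n" for n
    by (simp add: cos_add)
  moreover have "(\<Sum>n<M. (-1) ^ n :: real) = 0"
    using assms(1) by (simp add: geometric_sum)
  ultimately show ?thesis
    by (simp flip: sum_distrib_left)
qed

text \<open>Only \<open>k = 0\<close> survives; its factor \<open>M\<close> cancels the
  normalisation \<open>1 / M\<close>, and \<open>dft M x 0\<close> is the plain sum of the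
  entries.\<close>

lemma sum_cont_rep_shifted_grid:
  assumes "M > 0" "T \<noteq> 0"
  shows "(\<Sum>n<M. cont_rep M T x (real n * T + d)) = of_real (\<Sum>n<M. x n)"
proof -
  let ?K = "{k::int. \<bar>real_of_int k\<bar> < real M / 2}"
  let ?e = "\<lambda>k n. exp (2 * of_real pi * \<i> * of_int k * of_real (real n * T + d) / of_real (real M * T))
    :: complex"
  \<comment> \<open>Finiteness lets the delta sum below pick out \<open>k = 0\<close>; over an
    infinite set \<open>sum\<close> would default to 0.\<close>
  have "?K \<subseteq> {- int M..int M}"
    by auto
  then have fin: "finite ?K"
    by (rule finite_subset) simp
  have "(\<Sum>n<M. \<Sum>k\<in>?K. dft M x k * ?e k n) = (\<Sum>k\<in>?K. dft M x k * (\<Sum>n<M. ?e k n))"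
    by (subst sum.swap) (simp only: sum_distrib_left)
  also have "\<dots> = (\<Sum>k\<in>?K. if k = 0 then dft M x 0 * of_nat M else 0)"
  proof (rule sum.cong[OF refl])
    fix k assume "k \<in> ?K"
    then have "\<bar>real_of_int k\<bar> < real M"
      by auto
    then show "dft M x k * (\<Sum>n<M. ?e k n) = (if k = 0 then dft M x 0 * of_nat M else 0)"
      by (simp only: sum_shifted_character[OF assms]) auto
  qed
  also have "\<dots> = dft M x 0 * of_nat M"
    using fin assms(1) by (simp add: sum.delta')
  finally have low: "(\<Sum>n<M. \<Sum>k\<in>?K. dft M x k * ?e k n) = dft M x 0 * of_nat M" .
  have nyquist: "(\<Sum>n<M. (if even M then 1 else 0) *
      (1 / of_nat M * dft M x (int (M div 2)) * of_real (cos (pi * (real n * T + d) / T)))) = 0"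
    \<comment> \<open>The cosines are gathered under a single \<open>of_real\<close>, where the real
      identity applies.\<close>
    using sum_shifted_nyquist[of M T d] assms(2)
    by (simp only: sum_distrib_left[symmetric] of_real_sum[symmetric]) (simp del: of_real_sum)
  have "(\<Sum>n<M. cont_rep M T x (real n * T + d)) = dft M x 0"
    unfolding cont_rep_def sum.distrib nyquist
    using assms(1) by (simp only: sum_distrib_left[symmetric] low) simp
  then show ?thesis
    by (simp add: dft_def)
qed

lemma sum_frac_translate:
  assumes "M > 0" "T \<noteq> 0"
  shows "(\<Sum>n<M. frac_translate M T \<Delta> x n) = (\<Sum>n<M. x n)"
proof -
  have "(\<Sum>n<M. frac_translate M T \<Delta> x n) = Re (\<Sum>n<M. cont_rep M T x (real n * T + \<Delta>))"
    by (simp add: frac_translate_def)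
  then show ?thesis
    by (simp only: sum_cont_rep_shifted_grid[OF assms] Re_complex_of_real)
qed

lemma shift_invariant_global_avg_pool:
  assumes "M > 0" "T \<noteq> 0"
  shows "shift_invariant C M T (global_avg_pool C M)"
  using assms
  \<comment> \<open>A translated signal is \<open>undefined\<close> at channels from
    \<open>C\<close> on, so channels are compared only under \<open>c < C\<close>, which
    \<open>restrict_cong\<close> supplies.\<close>
  by (auto simp: shift_invariant_def global_avg_pool_def signal_translate_def sum_frac_translate
      cong: restrict_cong)

theorem proposition1:
  fixes N M Cin C q :: nat
    and T T' :: real
    and f :: "(nat \<Rightarrow> nat \<Rightarrow> real) \<Rightarrow> (nat \<Rightarrow> nat \<Rightarrow> real)"
    and g :: "(nat \<Rightarrow> real) \<Rightarrow> (nat \<Rightarrow> real)"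
  assumes "N \<ge> 1" and "M \<ge> 1" and "Cin \<ge> 1" and "C \<ge> 1"
    and "T > 0" and "T' > 0"
    and "real N * T = real M * T'"
    and "f \<in> signals Cin N \<rightarrow> signals C M"
    and "shift_equivariant Cin N T C M T' f"
    and "g \<in> real_vecs C \<rightarrow> real_vecs q"
  shows "shift_invariant Cin N T (g \<circ> global_avg_pool C M \<circ> f)"
  \<comment> \<open>Equivariance turns the input shift into a shift of \<open>f x\<close> with
    period \<open>T'\<close>; as \<open>f x\<close> lies in \<open>signals C M\<close>, pooling
    absorbs it before \<open>g\<close> is applied.\<close>
  using shift_invariant_global_avg_pool[of M T' C] assms
  by (auto simp: shift_invariant_def shift_equivariant_def dest: funcset_mem)

end
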